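(* Let $X\subseteq\mathbb{R}^d$ be a set of points. If $X$ is complete, then the lattices $\mathscr{K}(X)$ and $\mathscr{R}(X)$ are isomorphic, $\mathscr{K}(X)\cong\mathscr{R}(X)$.
   Context: For $A\subseteq\mathbb{R}^d$, $\mathrm{ch}(A)$ denotes the convex hull of $A$. The family $\mathscr{K}$ of all convex subsets of $\mathbb{R}^d$ is a lattice with operations $A\vee B=\mathrm{ch}(A\cup B)$ and $A\wedge B=A\cap B$. For $X\subseteq\mathbb{R}^d$, $\mathscr{K}(X)$ (the convex lattice, or point-generated lattice, of $X$) is the smallest sublattice of $\mathscr{K}$ containing all the singletons $\{x\}$, $x\in X$. The completion of $X$ is $\overline{X}=\{x\in\mathbb{R}^d \mid \{x\}\in\mathscr{K}(X)\}$, and $X$ is called complete if $\overline{X}=X$. For $A\subseteq X$, the relative convex hull of $A$ with respect to $X$ is $\mathrm{Rch}_X(A)=\mathrm{ch}(A)\cap X$; a subset $A\subseteq X$ is relatively convex if $\mathrm{Rch}_X(A)=A$. The relative lattice of $X$ is the set $\mathscr{R}(X)=\{\mathrm{Rch}_X(Y)\mid Y\subseteq X\}$ of relatively convex subsets of $X$, with operations $A\vee_R B=\mathrm{Rch}_X(A\cup B)$ and $A\wedge_R B=A\cap B$.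
   Formalization: The set X is additionally assumed finite with at least two points; the claim fails for every infinite complete X (e.g. X = R^d, where K(X) has no greatest element) and for |X| ≤ 1, where K(X) lacks the empty set that R(X) contains. *)

theory Defs
  imports "HOL-Analysis.Analysis"
begin

definition conv_join :: "(real ^ 'n) set \<Rightarrow> (real ^ 'n) set \<Rightarrow> (real ^ 'n) set" where
  "conv_join A B = convex hull (A \<union> B)"

definition is_sublattice ::
  "('a \<Rightarrow> 'a \<Rightarrow> 'a) \<Rightarrow> ('a \<Rightarrow> 'a \<Rightarrow> 'a) \<Rightarrow> 'a set \<Rightarrow> 'a set \<Rightarrow> bool" where
  "is_sublattice jn mt L S \<longleftrightarrow>
     S \<subseteq> L \<and> (\<forall>a\<in>S. \<forall>b\<in>S. jn a b \<in> S \<and> mt a b \<in> S)"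

definition lattice_isomorphic ::
  "'a set \<Rightarrow> ('a \<Rightarrow> 'a \<Rightarrow> 'a) \<Rightarrow> ('a \<Rightarrow> 'a \<Rightarrow> 'a) \<Rightarrow>
   'b set \<Rightarrow> ('b \<Rightarrow> 'b \<Rightarrow> 'b) \<Rightarrow> ('b \<Rightarrow> 'b \<Rightarrow> 'b) \<Rightarrow> bool" where
  "lattice_isomorphic L jn mt L' jn' mt' \<longleftrightarrow>
     (\<exists>f. bij_betw f L L' \<and>
        (\<forall>a\<in>L. \<forall>b\<in>L. f (jn a b) = jn' (f a) (f b) \<and> f (mt a b) = mt' (f a) (f b)))"

text \<open>The empty set is convex, but a sublattice is closed under binary operations only:
  the empty set belongs to the lattice generated by \<open>X\<close> exactly when \<open>X\<close> has at least two
  points (as the meet of two singletons).\<close>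

definition convex_lattice :: "(real ^ 'n) set \<Rightarrow> (real ^ 'n) set set" where
  "convex_lattice X =
     \<Inter>{S. is_sublattice conv_join (\<inter>) {C. convex C} S \<and> (\<forall>x\<in>X. {x} \<in> S)}"

definition completion :: "(real ^ 'n) set \<Rightarrow> (real ^ 'n) set" where
  "completion X = {x. {x} \<in> convex_lattice X}"

definition complete_points :: "(real ^ 'n) set \<Rightarrow> bool" where
  "complete_points X \<longleftrightarrow> completion X = X"

definition rel_convex_hull :: "(real ^ 'n) set \<Rightarrow> (real ^ 'n) set \<Rightarrow> (real ^ 'n) set" where
  "rel_convex_hull X A = convex hull A \<inter> X"

definition rel_join ::
  "(real ^ 'n) set \<Rightarrow> (real ^ 'n) set \<Rightarrow> (real ^ 'n) set \<Rightarrow> (real ^ 'n) set" where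
  "rel_join X A B = rel_convex_hull X (A \<union> B)"

definition relative_lattice :: "(real ^ 'n) set \<Rightarrow> (real ^ 'n) set set" where
  "relative_lattice X = {rel_convex_hull X Y |Y. Y \<subseteq> X}"

lemma is_sublattice_convex_lattice:
  "is_sublattice conv_join (\<inter>) {C. convex C} (convex_lattice X)"
proof -
  have "is_sublattice conv_join (\<inter>) {C. convex C} {C. convex C}"
    unfolding is_sublattice_def conv_join_def
    by (auto simp: convex_Int)
  then have "convex_lattice X \<subseteq> {C. convex C}"
    unfolding convex_lattice_def by (intro Inter_lower) auto
  then show ?thesis
    unfolding is_sublattice_def convex_lattice_def by auto
qed

lemma singleton_in_convex_lattice: "x \<in> X \<Longrightarrow> {x} \<in> convex_lattice X"
  unfolding convex_lattice_def by auto

lemma convex_lattice_least: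
  assumes "is_sublattice conv_join (\<inter>) {C. convex C} S" "\<And>x. x \<in> X \<Longrightarrow> {x} \<in> S"
  shows "convex_lattice X \<subseteq> S"
  using assms unfolding convex_lattice_def by auto

lemma relative_lattice_iff:
  "A \<in> relative_lattice X \<longleftrightarrow> A \<subseteq> X \<and> rel_convex_hull X A = A"
proof
  assume "A \<in> relative_lattice X"
  then obtain Y where Y: "Y \<subseteq> X" "A = convex hull Y \<inter> X"
    unfolding relative_lattice_def rel_convex_hull_def by blast
  have "convex hull A \<subseteq> convex hull Y"
    using Y by (intro hull_minimal) auto
  moreover have "A \<subseteq> convex hull A"
    by (rule hull_subset)
  ultimately show "A \<subseteq> X \<and> rel_convex_hull X A = A"
    using Y unfolding rel_convex_hull_def by auto
next
  assume "A \<subseteq> X \<and> rel_convex_hull X A = A"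
  then show "A \<in> relative_lattice X"
    unfolding relative_lattice_def by blast
qed

lemma relative_lattice_closed:
  assumes "A \<in> relative_lattice X" "B \<in> relative_lattice X"
  shows "rel_join X A B \<in> relative_lattice X" "A \<inter> B \<in> relative_lattice X"
proof -
  have AB: "A \<subseteq> X" "B \<subseteq> X" "convex hull A \<inter> X = A" "convex hull B \<inter> X = B"
    using assms unfolding relative_lattice_iff rel_convex_hull_def by auto
  then show "rel_join X A B \<in> relative_lattice X"
    unfolding rel_join_def relative_lattice_def by blast
  have "convex hull (A \<inter> B) \<subseteq> convex hull A \<inter> convex hull B"
    by (intro Int_greatest hull_mono) auto
  moreover have "A \<inter> B \<subseteq> convex hull (A \<inter> B)"
    by (rule hull_subset)
  ultimately show "A \<inter> B \<in> relative_lattice X"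
    using AB unfolding relative_lattice_iff rel_convex_hull_def by blast
qed

end

theory Submission
  imports Defs
begin

text \<open>
  The isomorphism is the trace map \<open>A \<mapsto> A \<inter> X\<close>, with inverse \<open>Y \<mapsto> convex hull Y\<close> on the
  relatively convex sets.  Since \<open>X\<close> is finite, these hulls do lie in the convex lattice, being
  iterated joins of singletons.  Everything else hinges on showing that each \<open>A\<close> in the convex lattice is the convex hull of its trace
  (lemma \<open>eq_hull_trace\<close>).  Since \<open>A\<close> is a polytope, it is the hull of its vertices, so it
  suffices that every vertex \<open>v\<close> lies in \<open>X\<close>; by completeness this means that the singleton \<open>{v}\<close>
  belongs to the convex lattice.

  The statement about vertices does not survive an induction over the lattice operations, as a
  vertex of \<open>A \<inter> B\<close> need not be a vertex of \<open>A\<close> or of \<open>B\<close>.  The statement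
  \<^emph>\<open>every face of \<open>A\<close> belongs to the lattice\<close> does (lemma \<open>face_in_convex_lattice\<close>): a face of
  \<open>convex hull (A \<union> B)\<close> is spanned by a face of \<open>A\<close> and a face of \<open>B\<close>, and a face of \<open>A \<inter> B\<close> is
  the intersection of a face of \<open>A\<close> and a face of \<open>B\<close>.  A vertex is a one-point face.
  One of the two faces may be empty, which is harmless because the empty set is the meet of
  two distinct singletons.
\<close>

text \<open>The smallest face containing \<open>F\<close> will do.  If a relative interior point of \<open>F\<close> were on the
  relative boundary of that face, it would lie in a strictly smaller face; but a face that meets
  the relative interior of \<open>F\<close> contains \<open>F\<close>, contradicting minimality.\<close>

lemma polyhedron_face_engulfing_rel_interior:
  fixes A F :: "'a::euclidean_space set"
  assumes A: "polyhedron A" and F: "F \<subseteq> A"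
  obtains G where "G face_of A" "F \<subseteq> G" "rel_interior F \<subseteq> rel_interior G"
proof -
  define G where "G = \<Inter>{H. H face_of A \<and> F \<subseteq> H}"
  have "A face_of A"
    using A by (simp add: face_of_refl polyhedron_imp_convex)
  then have G: "G face_of A"
    unfolding G_def using F by (intro face_of_Inter) auto
  have FG: "F \<subseteq> G"
    unfolding G_def by blast
  have polyG: "polyhedron G"
    using A G by (rule face_of_polyhedron_polyhedron)
  have "rel_interior F \<subseteq> rel_interior G"
  proof
    fix x
    assume x: "x \<in> rel_interior F"
    then have xG: "x \<in> G"
      using FG rel_interior_subset by blast
    show "x \<in> rel_interior G"
    proof (rule ccontr)
      assume "x \<notin> rel_interior G"
      then have "x \<in> rel_frontier G"
        using xG closure_subset unfolding rel_frontier_def by blast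
      then obtain H where H: "H face_of G" "H \<noteq> G" "x \<in> H"
        unfolding rel_frontier_of_polyhedron_alt[OF polyG] by blast
      have "F \<subseteq> H"
        using H x FG by (intro subset_of_face_of[of H G F]) auto
      moreover have "H face_of A"
        using H(1) G by (rule face_of_trans)
      ultimately have "G \<subseteq> H"
        unfolding G_def by blast
      with H show False
        using face_of_imp_subset by blast
    qed
  qed
  then show thesis
    using that G FG by blast
qed

text \<open>Take for the two faces the smallest ones containing \<open>F\<close>.  A relative interior point of \<open>F\<close>
  is then interior relative to both of them, hence to their intersection, so the face \<open>F\<close> absorbs
  that intersection.\<close>

lemma face_of_Int_polyhedra:
  fixes A B F :: "'a::euclidean_space set"
  assumes A: "polyhedron A" and B: "polyhedron B" and F: "F face_of A \<inter> B"
  obtains G H where "G face_of A" "H face_of B" "F = G \<inter> H"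
proof (cases "F = {}")
  case True
  then show thesis
    using that[of "{}" "{}"] by simp
next
  case False
  have FAB: "F \<subseteq> A \<inter> B"
    using F by (rule face_of_imp_subset)
  obtain G where G: "G face_of A" "F \<subseteq> G" "rel_interior F \<subseteq> rel_interior G"
    using polyhedron_face_engulfing_rel_interior[OF A] FAB by blast
  obtain H where H: "H face_of B" "F \<subseteq> H" "rel_interior F \<subseteq> rel_interior H"
    using polyhedron_face_engulfing_rel_interior[OF B] FAB by blast
  obtain x where x: "x \<in> rel_interior F"
    using False face_of_imp_convex[OF F] rel_interior_eq_empty by blast
  have convGH: "convex G" "convex H"
    using G H face_of_imp_convex by blast+
  have "rel_interior (G \<inter> H) = rel_interior G \<inter> rel_interior H"
    using convex_rel_interior_inter_two[OF convGH] x G H by blast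
  then have "x \<in> rel_interior (G \<inter> H)"
    using x G H by blast
  moreover have "x \<in> F"
    using x rel_interior_subset by blast
  moreover have "G \<inter> H \<subseteq> A \<inter> B"
    using G H face_of_imp_subset by blast
  ultimately have "G \<inter> H \<subseteq> F"
    using F by (intro subset_of_face_of[of F "A \<inter> B"]) auto
  then show thesis
    using that G H by blast
qed

text \<open>The two faces are \<open>F \<inter> A\<close> and \<open>F \<inter> B\<close>: they span \<open>F\<close> because a face of the hull of a compact
  set is the hull of points of that set.\<close>

lemma face_of_convex_hull_Un:
  fixes A B F :: "'a::euclidean_space set"
  assumes A: "compact A" "convex A" and B: "compact B" "convex B"
    and F: "F face_of convex hull (A \<union> B)"
  obtains G H where "G face_of A" "H face_of B" "F = convex hull (G \<union> H)"
proof -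
  have sub: "A \<subseteq> convex hull (A \<union> B)" "B \<subseteq> convex hull (A \<union> B)"
    using hull_subset[of "A \<union> B" convex] by auto
  obtain S where S: "S \<subseteq> A \<union> B" "F = convex hull S"
    using face_of_convex_hull_subset[OF compact_Un[OF A(1) B(1)] F] .
  have "S \<subseteq> F"
    unfolding S(2) by (rule hull_subset)
  then have "S \<subseteq> (F \<inter> A) \<union> (F \<inter> B)"
    using S by blast
  then have "F \<subseteq> convex hull ((F \<inter> A) \<union> (F \<inter> B))"
    by (subst S(2)) (rule hull_mono)
  moreover have "convex hull ((F \<inter> A) \<union> (F \<inter> B)) \<subseteq> F"
    using face_of_imp_convex[OF F] by (intro hull_minimal) auto
  moreover have "F \<inter> A face_of A" "F \<inter> B face_of B"
    using face_of_slice[OF F A(2)] face_of_slice[OF F B(2)] sub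
    by (simp_all only: Int_absorb1)
  ultimately show thesis
    using that by blast
qed

lemma polytope_convex_hull_Un:
  fixes A B :: "'a::euclidean_space set"
  assumes "polytope A" "polytope B"
  shows "polytope (convex hull (A \<union> B))"
proof -
  obtain S where S: "finite S" "A = convex hull S"
    using assms(1) unfolding polytope_def by auto
  obtain T where T: "finite T" "B = convex hull T"
    using assms(2) unfolding polytope_def by auto
  have "convex hull (A \<union> B) = convex hull (S \<union> T)"
    unfolding S(2) T(2) by (simp only: hull_Un_left[symmetric] hull_Un_right[symmetric])
  then show ?thesis
    using S(1) T(1) unfolding polytope_def by (intro exI[of _ "S \<union> T"]) simp
qed

lemma conv_join_in_convex_lattice:
  "A \<in> convex_lattice X \<Longrightarrow> B \<in> convex_lattice X \<Longrightarrow> conv_join A B \<in> convex_lattice X"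
  using is_sublattice_convex_lattice unfolding is_sublattice_def by blast

lemma Int_in_convex_lattice:
  "A \<in> convex_lattice X \<Longrightarrow> B \<in> convex_lattice X \<Longrightarrow> A \<inter> B \<in> convex_lattice X"
  using is_sublattice_convex_lattice unfolding is_sublattice_def by blast

lemma empty_in_convex_lattice:
  assumes "x \<in> X" "y \<in> X" "x \<noteq> y"
  shows "{} \<in> convex_lattice X"
proof -
  have "{x} \<inter> {y} \<in> convex_lattice X"
    using assms by (intro Int_in_convex_lattice singleton_in_convex_lattice)
  then show ?thesis
    using assms by simp
qed

text \<open>The polytopes all of whose faces lie in the convex lattice form a sublattice containing
  the singletons, so they exhaust the convex lattice.  Being a polytope is carried along because
  the two descriptions of faces above need it.\<close>

lemma polytope_and_faces_in_convex_lattice: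
  fixes X :: "(real ^ 'n) set"
  assumes empty: "{} \<in> convex_lattice X" and A: "A \<in> convex_lattice X"
  shows "polytope A \<and> (\<forall>F. F face_of A \<longrightarrow> F \<in> convex_lattice X)"
proof -
  define S where "S = {A. polytope A \<and> (\<forall>F. F face_of A \<longrightarrow> F \<in> convex_lattice X)}"
  have "is_sublattice conv_join (\<inter>) {C. convex C} S"
    unfolding is_sublattice_def
  proof (intro conjI ballI)
    show "S \<subseteq> {C. convex C}"
      unfolding S_def by (auto simp: polytope_imp_convex)
  next
    fix A B
    assume "A \<in> S" "B \<in> S"
    then have AB: "polytope A" "polytope B"
      and faces: "\<And>F. F face_of A \<Longrightarrow> F \<in> convex_lattice X"
        "\<And>F. F face_of B \<Longrightarrow> F \<in> convex_lattice X"
      unfolding S_def by auto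
    have "F \<in> convex_lattice X" if F: "F face_of conv_join A B" for F
    proof -
      obtain G H where "G face_of A" "H face_of B" and "F = conv_join G H"
        using face_of_convex_hull_Un[OF AB(1)[THEN polytope_imp_compact]
            AB(1)[THEN polytope_imp_convex] AB(2)[THEN polytope_imp_compact]
            AB(2)[THEN polytope_imp_convex] F[unfolded conv_join_def]]
        unfolding conv_join_def .
      then show ?thesis
        by (simp add: faces conv_join_in_convex_lattice)
    qed
    then show "conv_join A B \<in> S"
      using polytope_convex_hull_Un[OF AB] by (simp add: S_def conv_join_def)
    have "F \<in> convex_lattice X" if F: "F face_of A \<inter> B" for F
    proof -
      obtain G H where "G face_of A" "H face_of B" "F = G \<inter> H"
        using face_of_Int_polyhedra[OF AB[THEN polytope_imp_polyhedron] F] .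
      then show ?thesis
        by (simp add: faces Int_in_convex_lattice)
    qed
    then show "A \<inter> B \<in> S"
      using polytope_Int[OF AB] by (simp add: S_def)
  qed
  moreover have "{x} \<in> S" if "x \<in> X" for x
  proof -
    have "F = {} \<or> F = {x}" if "F face_of {x}" for F
      using face_of_imp_subset[OF that] by blast
    then show ?thesis
      using empty singleton_in_convex_lattice[OF that] polytope_sing[of x]
      unfolding S_def by auto
  qed
  ultimately have "convex_lattice X \<subseteq> S"
    by (intro convex_lattice_least)
  then have "A \<in> S"
    using A by (rule subsetD)
  then show ?thesis
    unfolding S_def by simp
qed

lemma polytope_convex_lattice:
  assumes "{} \<in> convex_lattice X" "A \<in> convex_lattice X"
  shows "polytope A"
  using polytope_and_faces_in_convex_lattice[OF assms] ..

lemma face_in_convex_lattice: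
  assumes "{} \<in> convex_lattice X" "A \<in> convex_lattice X" "F face_of A"
  shows "F \<in> convex_lattice X"
  using polytope_and_faces_in_convex_lattice[OF assms(1,2)] assms(3) by simp

text \<open>By Minkowski's theorem \<open>A\<close> is the hull of its vertices; each vertex is a face, so completeness
  puts it into \<open>X\<close>.\<close>

lemma eq_hull_trace:
  fixes X :: "(real ^ 'n) set"
  assumes complete: "complete_points X" and empty: "{} \<in> convex_lattice X"
    and A: "A \<in> convex_lattice X"
  shows "A = convex hull (A \<inter> X)"
proof
  have poly: "polytope A"
    using empty A by (rule polytope_convex_lattice)
  have "v \<in> A \<inter> X" if v: "v extreme_point_of A" for v
  proof -
    have "{v} \<in> convex_lattice X"
      using face_in_convex_lattice[OF empty A] v by (simp add: face_of_singleton)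
    then have "v \<in> X"
      using complete unfolding complete_points_def completion_def by blast
    then show ?thesis
      using v unfolding extreme_point_of_def by blast
  qed
  then have "convex hull {v. v extreme_point_of A} \<subseteq> convex hull (A \<inter> X)"
    by (intro hull_mono) blast
  then show "A \<subseteq> convex hull (A \<inter> X)"
    using Krein_Milman_Minkowski[of A] poly polytope_imp_compact polytope_imp_convex by blast
  show "convex hull (A \<inter> X) \<subseteq> A"
    using poly by (intro hull_minimal) (auto simp: polytope_imp_convex)
qed

lemma convex_hull_in_convex_lattice:
  fixes X :: "(real ^ 'n) set"
  assumes "finite Y" "Y \<subseteq> X" "{} \<in> convex_lattice X"
  shows "convex hull Y \<in> convex_lattice X"
  using assms
proof (induction Y rule: finite_induct)
  case empty
  then show ?case by simp
next
  case (insert y Y)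
  have "convex hull (insert y Y) = conv_join {y} (convex hull Y)"
    using hull_Un_right[of convex "{y}" Y] by (simp add: conv_join_def)
  then show ?case
    using insert conv_join_in_convex_lattice[of "{y}" X "convex hull Y"]
    by (simp add: singleton_in_convex_lattice)
qed

theorem theorem5:
  fixes X :: "(real ^ 'n) set"
  assumes "finite X" and "2 \<le> card X"
    and "complete_points X"
  shows "lattice_isomorphic (convex_lattice X) conv_join (\<inter>)
           (relative_lattice X) (rel_join X) (\<inter>)"
proof -
  obtain x y where "x \<in> X" "y \<in> X" "x \<noteq> y"
    using assms(1,2) card_le_Suc0_iff_eq[of X] by fastforce
  then have empty: "{} \<in> convex_lattice X"
    by (rule empty_in_convex_lattice)
  note trace = eq_hull_trace[OF assms(3) empty]
  define f where "f = (\<lambda>A. A \<inter> X)"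
  have "inj_on f (convex_lattice X)"
  proof (rule inj_onI)
    fix A B
    assume AB: "A \<in> convex_lattice X" "B \<in> convex_lattice X" and "f A = f B"
    then have "convex hull (A \<inter> X) = convex hull (B \<inter> X)"
      unfolding f_def by simp
    then show "A = B"
      using trace[OF AB(1), symmetric] trace[OF AB(2), symmetric] by simp
  qed
  moreover have "f ` convex_lattice X = relative_lattice X"
  proof
    have "rel_convex_hull X (A \<inter> X) = A \<inter> X" if "A \<in> convex_lattice X" for A
      using trace[OF that, symmetric] unfolding rel_convex_hull_def by simp
    then show "f ` convex_lattice X \<subseteq> relative_lattice X"
      by (auto simp: f_def relative_lattice_iff)
    show "relative_lattice X \<subseteq> f ` convex_lattice X"
    proof
      fix Z
      assume "Z \<in> relative_lattice X"
      then obtain Y where Y: "Y \<subseteq> X" "Z = f (convex hull Y)"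
        unfolding relative_lattice_def rel_convex_hull_def f_def by blast
      have "convex hull Y \<in> convex_lattice X"
        using finite_subset[OF Y(1) assms(1)] Y(1) empty by (rule convex_hull_in_convex_lattice)
      then show "Z \<in> f ` convex_lattice X"
        using Y(2) by (rule rev_image_eqI)
    qed
  qed
  moreover have "f (conv_join A B) = rel_join X (f A) (f B)"
    if "A \<in> convex_lattice X" "B \<in> convex_lattice X" for A B
  proof -
    have "convex hull (A \<union> B) = convex hull (convex hull (A \<inter> X) \<union> convex hull (B \<inter> X))"
      using trace[OF that(1), symmetric] trace[OF that(2), symmetric] by simp
    also have "\<dots> = convex hull ((A \<inter> X) \<union> (B \<inter> X))"
      by (simp only: hull_Un_left[symmetric] hull_Un_right[symmetric])
    finally show ?thesis
      unfolding f_def conv_join_def rel_join_def rel_convex_hull_def by simp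
  qed
  moreover have "f (A \<inter> B) = f A \<inter> f B" for A B
    unfolding f_def by blast
  ultimately show ?thesis
    unfolding lattice_isomorphic_def bij_betw_def by (intro exI[of _ f]) simp
qed

end
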